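(* Let $G=(\mathcal V,\mathcal E)$ be a graph with $\mathcal V\subset\mathbb R^d$ uniformly discrete of radius $r>0$. Assume that $G$ has maximal vertex degree $d_{\max}:=\sup_{v\in\mathcal V}d_G(v)\in\mathbb N\setminus\{1\}$ and maximal edge length $l_{\max}:=\sup\{|u-v|:\{u,v\}\in\mathcal E\}<\infty$. Then, for every $p\in[0,\frac1{d_{\max}-1}[$, there exists a constant $\lambda(p)\in\,]0,\infty[$, which besides $p$ depends only on $r$, $d_{\max}$ and $l_{\max}$, such that $$\mathbb P_G^p\bigl(|C_v|\ge n\bigr)\le2\,e^{-n\lambda(p)}$$ for all $n\in\mathbb N$, uniformly in $v\in\mathcal V$.
   Context: Graphs are simple (no loops, no multiple edges) with countable vertex set in a fixed Euclidean space $\mathbb R^d$; $d_G(v)$ is the degree of $v$. The vertex set is uniformly discrete of radius $r$ if every open ball of radius $r$ in $\mathbb R^d$ contains at most one vertex. Bernoulli bond percolation: $\Omega_G:=\{0,1\}^{\mathcal E}$ with product measure $\mathbb P_G^p:=\bigotimes_{e\in\mathcal E}(p\,\delta_1+(1-p)\delta_0)$; for $\omega\in\Omega_G$, $G^{(\omega)}$ is the subgraph with vertex set $\mathcal V$ and edge set $\{e\in\mathcal E:\omega_e=1\}$, and $C_v=C_v^{(\omega)}$ is the connected component (cluster) of $G^{(\omega)}$ containing $v$, with $|C_v|$ its number of vertices. *)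

theory Defs
  imports "HOL-Probability.Probability" "HOL-Library.Extended_Nat"
begin

definition ecard :: "'a set \<Rightarrow> enat" where
  "ecard A = (if finite A then enat (card A) else \<infinity>)"

(* Edges are two-element sets {u, v}, so loops and multiple edges are excluded. *)
definition simple_graph :: "'a set \<Rightarrow> 'a set set \<Rightarrow> bool" where
  "simple_graph V E \<longleftrightarrow>
     countable V \<and> (\<forall>e\<in>E. \<exists>u v. u \<in> V \<and> v \<in> V \<and> u \<noteq> v \<and> e = {u, v})"

definition uniformly_discrete_of_radius :: "real \<Rightarrow> 'a::metric_space set \<Rightarrow> bool" where
  "uniformly_discrete_of_radius r V \<longleftrightarrow> (\<forall>x. ecard (V \<inter> ball x r) \<le> 1)"

definition degree :: "'a set set \<Rightarrow> 'a \<Rightarrow> enat" where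
  "degree E v = ecard {e \<in> E. v \<in> e}"

definition max_degree :: "'a set \<Rightarrow> 'a set set \<Rightarrow> enat" where
  "max_degree V E = (SUP v\<in>V. degree E v)"

(* The supremum is taken in [0, infinity]. *)
definition max_edge_length :: "'a::metric_space set set \<Rightarrow> ennreal" where
  "max_edge_length E = Sup {ennreal (dist u v) | u v. {u, v} \<in> E}"

(* Bernoulli bond percolation; True and False stand for the values 1 and 0, so that
   bernoulli_pmf p is p delta_1 + (1 - p) delta_0 for p in [0, 1]. *)
definition bond_percolation :: "'a set set \<Rightarrow> real \<Rightarrow> ('a set \<Rightarrow> bool) measure" where
  "bond_percolation E p = PiM E (\<lambda>_. measure_pmf (bernoulli_pmf p))"

definition open_edges :: "'a set set \<Rightarrow> ('a set \<Rightarrow> bool) \<Rightarrow> 'a set set" where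
  "open_edges E \<omega> = {e \<in> E. \<omega> e}"

(* Vertex set of the connected component of v in the graph with edge set F; the closure is
   reflexive, so an isolated vertex is a cluster of size 1. *)
definition cluster :: "'a set set \<Rightarrow> 'a \<Rightarrow> 'a set" where
  "cluster F v = {w. (v, w) \<in> {(x, y). {x, y} \<in> F}\<^sup>*}"

end

(* Reveal the edges one at a time, always one that touches the part of the cluster found so far.
   An open edge adds at most one vertex and d - 1 further touching edges, so with a vertices found
   and b touching edges the weight z^a g^b is a supermartingale as soon as
   1 - p + p z g^(d-1) <= g. Such g, z > 1 exist because p (d - 1) < 1, and Markov's inequality
   gives P(|C_v| >= n) <= z g^d / z^n on finite graphs, hence in general by exhaustion. The prefactor
   is brought down to 2 by decreasing the rate. *)
theory Submission
  imports Defs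
begin

section \<open>Exploration of a cluster: vertices reachable from a seed set\<close>

text \<open>Seeds form a set because the exploration keeps all vertices found so far; a cluster is
  the case of a single seed.\<close>

definition reach :: "'a set set \<Rightarrow> 'a set \<Rightarrow> 'a set" where
  "reach F A = {(x, y). {x, y} \<in> F}\<^sup>* `` A"

lemma cluster_eq_reach: "cluster F v = reach F {v}"
  by (auto simp: cluster_def reach_def)

lemma reach_mono: "F \<subseteq> F' \<Longrightarrow> A \<subseteq> A' \<Longrightarrow> reach F A \<subseteq> reach F' A'"
  unfolding reach_def by (intro Image_mono rtrancl_mono) auto

lemma subset_reach: "A \<subseteq> reach F A"
  by (auto simp: reach_def)

lemma reach_step: "x \<in> reach F A \<Longrightarrow> {x, y} \<in> F \<Longrightarrow> y \<in> reach F A"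
  unfolding reach_def by (auto intro: rtrancl_into_rtrancl)

lemma reach_least:
  assumes "A \<subseteq> B" and "\<And>x y. x \<in> B \<Longrightarrow> {x, y} \<in> F \<Longrightarrow> y \<in> B"
  shows "reach F A \<subseteq> B"
proof
  fix y assume "y \<in> reach F A"
  then obtain x where "x \<in> A" and "(x, y) \<in> {(x, y). {x, y} \<in> F}\<^sup>*"
    by (auto simp: reach_def)
  from this(2) show "y \<in> B"
    by induction (use \<open>x \<in> A\<close> assms in auto)
qed

text \<open>The exploration ends in this situation: no edge leads out of \<open>A\<close>, so
  \<open>A\<close> is already closed under steps along \<open>F\<close>.\<close>

lemma reach_no_touching:
  assumes "\<And>e. e \<in> F \<Longrightarrow> e \<inter> A = {}"
  shows "reach F A = A"
  using assms by (intro antisym subset_reach reach_least) auto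

text \<open>An open edge at a seed \<open>x\<close> can be traded for its other endpoint as a new
  seed: both endpoints then count as found, and the edge yields nothing more. This lets a revealed
  edge be deleted from the graph.\<close>

lemma reach_insert:
  assumes "x \<in> A"
  shows "reach (insert {x, y} F) A = reach F (insert y A)"
proof (rule antisym)
  let ?R = "reach F (insert y A)"
  have "insert y A \<subseteq> ?R"
    by (rule subset_reach)
  then show "reach (insert {x, y} F) A \<subseteq> ?R"
  proof (intro reach_least)
    fix u v
    assume sub: "insert y A \<subseteq> ?R" and u: "u \<in> ?R" and "{u, v} \<in> insert {x, y} F"
    then consider "v = x" | "v = y" | "{u, v} \<in> F"
      by (auto simp: doubleton_eq_iff)
    then show "v \<in> ?R"
      using sub assms reach_step[OF u] by cases blast+
  qed blast
  let ?R' = "reach (insert {x, y} F) A"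
  have sub: "A \<subseteq> ?R'"
    by (rule subset_reach)
  then have "x \<in> ?R'"
    using assms by blast
  then have "y \<in> ?R'"
    by (rule reach_step) simp
  with sub show "?R \<subseteq> ?R'"
    by (intro reach_least insert_subsetI) (auto elim: reach_step)
qed

section \<open>Cluster size and finite witnesses\<close>

lemma ecard_mono: "A \<subseteq> B \<Longrightarrow> ecard A \<le> ecard B"
  by (auto simp: ecard_def card_mono finite_subset)

text \<open>Reduces a lower bound on the size of a possibly infinite cluster to a finite set of
  vertices, which the exhaustion argument can handle.\<close>

lemma enat_le_ecard_iff: "enat n \<le> ecard A \<longleftrightarrow> (\<exists>B\<subseteq>A. finite B \<and> card B = n)"
proof
  assume "enat n \<le> ecard A"
  then show "\<exists>B\<subseteq>A. finite B \<and> card B = n"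
    by (cases "finite A")
      (auto simp: ecard_def dest: obtain_subset_with_card_n infinite_arbitrarily_large)
next
  assume "\<exists>B\<subseteq>A. finite B \<and> card B = n"
  then show "enat n \<le> ecard A"
    by (auto simp: ecard_def card_mono)
qed

lemma finite_card_le_of_ecard_le: "ecard A \<le> enat d \<Longrightarrow> finite A \<and> card A \<le> d"
  by (auto simp: ecard_def split: if_splits)

text \<open>A path has only finitely many edges; the induction collects them step by step.\<close>

lemma reach_finite_support:
  assumes "y \<in> reach F A"
  shows "\<exists>F'\<subseteq>F. finite F' \<and> y \<in> reach F' A"
proof -
  obtain x where x: "x \<in> A" and "(x, y) \<in> {(x, y). {x, y} \<in> F}\<^sup>*"
    using assms by (auto simp: reach_def)
  from this(2) show ?thesis
  proof induction
    case base
    then show ?case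
      using x subset_reach[of A "{}"] by (intro exI[of _ "{}"]) auto
  next
    case (step y z)
    then obtain F' where F': "F' \<subseteq> F" "finite F'" "y \<in> reach F' A" by blast
    have "y \<in> reach (insert {y, z} F') A"
      using F'(3) reach_mono[OF subset_insertI order.refl] by (rule rev_subsetD)
    then have "z \<in> reach (insert {y, z} F') A"
      by (rule reach_step) simp
    moreover have "insert {y, z} F' \<subseteq> F"
      using F'(1) step.hyps(2) by simp
    ultimately show ?case
      using F'(2) by blast
  qed
qed

lemma reach_finite_subset:
  assumes "finite B" and "B \<subseteq> reach F A"
  shows "\<exists>F'\<subseteq>F. finite F' \<and> B \<subseteq> reach F' A"
proof -
  have "\<forall>y\<in>B. \<exists>F'. F' \<subseteq> F \<and> finite F' \<and> y \<in> reach F' A"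
    using assms(2) reach_finite_support by (metis subsetD)
  then obtain f where f: "\<forall>y\<in>B. f y \<subseteq> F \<and> finite (f y) \<and> y \<in> reach (f y) A"
    by (rule bchoice[THEN exE])
  have "B \<subseteq> reach (\<Union> (f ` B)) A"
  proof
    fix y
    assume "y \<in> B"
    moreover from this have "reach (f y) A \<subseteq> reach (\<Union> (f ` B)) A"
      by (intro reach_mono UN_upper order.refl)
    ultimately show "y \<in> reach (\<Union> (f ` B)) A"
      using f by blast
  qed
  moreover have "\<Union> (f ` B) \<subseteq> F" "finite (\<Union> (f ` B))"
    using f assms(1) by auto
  ultimately show ?thesis
    by blast
qed

section \<open>Finite marginals of the percolation measure and conditioning on one edge\<close>

lemma space_bond_percolation: "space (bond_percolation E p) = PiE E (\<lambda>_. UNIV)"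
  by (simp add: bond_percolation_def space_PiM)

lemma prob_space_bond_percolation: "prob_space (bond_percolation E p)"
  unfolding bond_percolation_def by (intro prob_space_PiM measure_pmf.prob_space_axioms)

text \<open>A finite product of two-point spaces is discrete, so on finite edge sets every event is
  measurable.\<close>

lemma sets_bond_percolation_finite:
  assumes "finite F"
  shows "sets (bond_percolation F p) = Pow (PiE F (\<lambda>_. UNIV))"
proof -
  have "sets (bond_percolation F p) = sets (PiM F (\<lambda>_. count_space (UNIV :: bool set)))"
    unfolding bond_percolation_def by (intro sets_PiM_cong) auto
  also have "\<dots> = Pow (PiE F (\<lambda>_. UNIV))"
    using assms by (subst count_space_PiM_finite) auto
  finally show ?thesis .
qed

lemma open_edges_restrict: "F \<subseteq> E \<Longrightarrow> open_edges F (restrict \<omega> F) = open_edges F \<omega>"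
  by (auto simp: open_edges_def)

text \<open>Such events are cylinders: \<open>open_edges F\<close> reads only the coordinates in
  \<open>F\<close>, and the marginal of the product measure on \<open>F\<close> is the percolation
  measure of \<open>F\<close>.\<close>

lemma
  assumes "finite F" and "F \<subseteq> E"
  shows sets_bond_percolation_open_edges:
      "{\<omega> \<in> space (bond_percolation E p). P (open_edges F \<omega>)} \<in> sets (bond_percolation E p)"
    and measure_bond_percolation_restrict:
      "measure (bond_percolation E p) {\<omega> \<in> space (bond_percolation E p). P (open_edges F \<omega>)} =
       measure (bond_percolation F p) {\<omega> \<in> space (bond_percolation F p). P (open_edges F \<omega>)}"
proof -
  interpret product_prob_space "\<lambda>_. measure_pmf (bernoulli_pmf p)" E
    by unfold_locales
  let ?S = "{\<omega> \<in> space (bond_percolation F p). P (open_edges F \<omega>)}"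
  have S: "?S \<in> sets (bond_percolation F p)"
    using assms(1) by (auto simp: sets_bond_percolation_finite space_bond_percolation)
  have meas: "(\<lambda>\<omega>. restrict \<omega> F) \<in> bond_percolation E p \<rightarrow>\<^sub>M bond_percolation F p"
    unfolding bond_percolation_def using assms(2) by (rule measurable_restrict_subset)
  have vimage: "(\<lambda>\<omega>. restrict \<omega> F) -` ?S \<inter> space (bond_percolation E p) =
      {\<omega> \<in> space (bond_percolation E p). P (open_edges F \<omega>)}"
    using open_edges_restrict[OF assms(2)] by (auto simp: space_bond_percolation)
  show "{\<omega> \<in> space (bond_percolation E p). P (open_edges F \<omega>)} \<in> sets (bond_percolation E p)"
    using measurable_sets[OF meas S] unfolding vimage .
  have "bond_percolation F p =
      distr (bond_percolation E p) (bond_percolation F p) (\<lambda>\<omega>. restrict \<omega> F)"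
    unfolding bond_percolation_def using distr_PiM_restrict_finite[OF assms] by simp
  then have "measure (bond_percolation F p) ?S =
      measure (distr (bond_percolation E p) (bond_percolation F p) (\<lambda>\<omega>. restrict \<omega> F)) ?S"
    by simp
  then show "measure (bond_percolation E p)
        {\<omega> \<in> space (bond_percolation E p). P (open_edges F \<omega>)} = measure (bond_percolation F p) ?S"
    by (simp only: measure_distr[OF meas S] vimage)
qed

text \<open>Conditioning on the state of \<open>e\<close>: a configuration on
  \<open>insert e F\<close> is an independent coin together with a configuration on
  \<open>F\<close>, glued by \<open>fun_upd\<close>.\<close>

lemma measure_bond_percolation_insert:
  assumes "finite F" and "e \<notin> F" and p: "0 \<le> p" "p \<le> 1"
  defines "\<mu> \<equiv> bond_percolation F p" and "\<nu> \<equiv> bond_percolation (insert e F) p"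
  shows "measure \<nu> {\<omega> \<in> space \<nu>. P (open_edges (insert e F) \<omega>)} =
    p * measure \<mu> {\<omega> \<in> space \<mu>. P (insert e (open_edges F \<omega>))} +
    (1 - p) * measure \<mu> {\<omega> \<in> space \<mu>. P (open_edges F \<omega>)}"
proof -
  interpret \<mu>: prob_space \<mu>
    unfolding \<mu>_def by (rule prob_space_bond_percolation)
  interpret \<nu>: prob_space \<nu>
    unfolding \<nu>_def by (rule prob_space_bond_percolation)
  let ?S = "{\<omega> \<in> space \<nu>. P (open_edges (insert e F) \<omega>)}"
  let ?B = "measure_pmf (bernoulli_pmf p)"
  let ?h = "\<lambda>(b, \<omega>). fun_upd \<omega> e b"
  have S: "?S \<in> sets \<nu>"
    using assms(1) by (auto simp: \<nu>_def sets_bond_percolation_finite space_bond_percolation)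
  have \<nu>: "\<nu> = distr (?B \<Otimes>\<^sub>M \<mu>) \<nu> ?h"
    unfolding \<mu>_def \<nu>_def bond_percolation_def
    by (rule distr_pair_PiM_eq_PiM[symmetric]) (auto intro: measure_pmf.prob_space_axioms)
  have h: "?h \<in> (?B \<Otimes>\<^sub>M \<mu>) \<rightarrow>\<^sub>M \<nu>"
    unfolding \<mu>_def \<nu>_def bond_percolation_def by measurable
  let ?T = "?h -` ?S \<inter> space (?B \<Otimes>\<^sub>M \<mu>)"
  \<comment> \<open>For a fixed coin value \<open>b\<close>, the section of the event lives on
    \<open>F\<close> alone; Fubini then averages over the two values.\<close>
  have slice: "Pair b -` ?T = {\<omega> \<in> space \<mu>. P (if b then insert e (open_edges F \<omega>) else open_edges F \<omega>)}" for b
  proof -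
    have upd: "fun_upd \<omega> e b \<in> space \<nu>" if "\<omega> \<in> space \<mu>" for \<omega>
      using that by (auto simp: \<mu>_def \<nu>_def space_bond_percolation PiE_def extensional_def)
    have "open_edges (insert e F) (fun_upd \<omega> e b) =
        (if b then insert e (open_edges F \<omega>) else open_edges F \<omega>)" for \<omega>
      using assms(2) by (auto simp: open_edges_def)
    with upd show ?thesis
      by (auto simp: space_pair_measure)
  qed
  have "emeasure \<nu> ?S = emeasure (?B \<Otimes>\<^sub>M \<mu>) ?T"
    by (subst \<nu>, subst emeasure_distr[OF h S]) simp
  also have "\<dots> = (\<integral>\<^sup>+ b. emeasure \<mu> (Pair b -` ?T) \<partial>?B)"
    by (rule \<mu>.emeasure_pair_measure_alt) (rule measurable_sets[OF h S])
  also have "\<dots> = ennreal p * emeasure \<mu> (Pair True -` ?T) +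
      ennreal (1 - p) * emeasure \<mu> (Pair False -` ?T)"
    using p by (subst nn_integral_bernoulli_pmf) (auto simp: mult.commute)
  also have "\<dots> = ennreal (p * measure \<mu> (Pair True -` ?T) + (1 - p) * measure \<mu> (Pair False -` ?T))"
    using p by (simp add: \<mu>.emeasure_eq_measure ennreal_mult)
  finally have "measure \<nu> ?S = p * measure \<mu> (Pair True -` ?T) + (1 - p) * measure \<mu> (Pair False -` ?T)"
    using p unfolding \<nu>.emeasure_eq_measure by (subst (asm) ennreal_inj) auto
  then show ?thesis
    by (simp only: slice if_True if_False)
qed

section \<open>The exponential bound on finite graphs\<close>

text \<open>Induction on the number of unrevealed edges, with the seed set \<open>A\<close>
  arbitrary because an open edge enlarges it. The supermartingale property is the induction step,
  and Markov's inequality sits in the base case.\<close>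

lemma measure_reach_ge_le:
  fixes g z p :: real and d n :: nat
  assumes p: "0 \<le> p" "p \<le> 1" and g: "1 \<le> g" and z: "1 \<le> z"
    and gz: "1 - p + p * z * g ^ (d - 1) \<le> g"
    and "finite F" and "finite A"
    and "\<And>e. e \<in> F \<Longrightarrow> \<exists>x y. e = {x, y}"
    and "\<And>x. card {e \<in> F. x \<in> e} \<le> d"
  shows "measure (bond_percolation F p)
      {\<omega> \<in> space (bond_percolation F p). ecard (reach (open_edges F \<omega>) A) \<ge> enat n}
    \<le> z ^ card A * g ^ card {e \<in> F. e \<inter> A \<noteq> {}} / z ^ n"
  using assms(6-9)
proof (induction "card F" arbitrary: F A rule: less_induct)
  case less
  interpret P: prob_space "bond_percolation F' p" for F' :: "'a set set"
    by (rule prob_space_bond_percolation)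
  let ?P = "\<lambda>F' A'. measure (bond_percolation F' p)
      {\<omega> \<in> space (bond_percolation F' p). ecard (reach (open_edges F' \<omega>) A') \<ge> enat n}"
  let ?T = "\<lambda>F' A'. {e \<in> F'. e \<inter> A' \<noteq> {}}"
  note finF = less.prems(1) and finA = less.prems(2)
  show ?case
  proof (cases "?T F A = {}")
    case True
    then have "reach (open_edges F \<omega>) A = A" for \<omega>
      by (intro reach_no_touching) (auto simp: open_edges_def)
    \<comment> \<open>The explored set is now deterministic, so the event is either certain or
      impossible.\<close>
    then have eq: "?P F A = (if n \<le> card A then 1 else 0)"
      using finA P.prob_space[of F] by (simp add: ecard_def)
    show ?thesis
    proof (cases "n \<le> card A")
      case nA: True
      then have "z ^ n \<le> z ^ card A"
        using z by (rule power_increasing)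
      then show ?thesis
        unfolding eq True using z nA by simp
    next
      case False
      then show ?thesis
        unfolding eq using z g by simp
    qed
  next
    case False
    then obtain e x where e: "e \<in> F" "x \<in> e" "x \<in> A"
      by blast
    moreover obtain u w where "e = {u, w}"
      using less.prems(3)[OF e(1)] by blast
    ultimately obtain y where "e = {x, y}"
      by (metis insertE insert_commute singletonD)
    with e have xy: "{x, y} \<in> F" "x \<in> A"
      by auto
    define F' where "F' = F - {{x, y}}"
    have F: "F = insert {x, y} F'" "{x, y} \<notin> F'" "finite F'"
      using xy(1) finF unfolding F'_def by blast+
    have lt: "card F' < card F"
      using F by simp
    have edges: "\<exists>x y. e = {x, y}" if "e \<in> F'" for e
      by (rule less.prems(3)) (use that in \<open>simp add: F'_def\<close>)
    have deg: "card {e \<in> F'. x \<in> e} \<le> d" for x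
    proof (rule order.trans[OF card_mono less.prems(4)])
      show "{e \<in> F'. x \<in> e} \<subseteq> {e \<in> F. x \<in> e}"
        unfolding F'_def by blast
    qed (use finF in simp)
    note IH = less.hyps[OF lt F(3) _ edges deg]
    define b where "b = card (?T F' A)"
    have "?T F A = insert {x, y} (?T F' A)"
      using xy F(1) by auto
    then have b: "card (?T F A) = Suc b"
      using F by (simp add: b_def)
    have closed: "?P F' A \<le> z ^ card A * g ^ b / z ^ n"
      unfolding b_def by (rule IH[OF finA])
    \<comment> \<open>The revealed edge \<open>{x, y}\<close> is one of the at most \<open>d\<close>
      edges at \<open>y\<close>, which leaves \<open>d - 1\<close> in \<open>F'\<close>.\<close>
    have new_edges: "card (?T F' (insert y A)) \<le> b + (d - 1)"
    proof -
      have "{e \<in> F. y \<in> e} = insert {x, y} {e \<in> F'. y \<in> e}"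
        using F(1) by auto
      then have "card {e \<in> F. y \<in> e} = Suc (card {e \<in> F'. y \<in> e})"
        using F by simp
      then have "card {e \<in> F'. y \<in> e} \<le> d - 1"
        using less.prems(4)[of y] by simp
      moreover have "?T F' (insert y A) = ?T F' A \<union> {e \<in> F'. y \<in> e}"
        by auto
      ultimately show ?thesis
        unfolding b_def using card_Un_le[of "?T F' A" "{e \<in> F'. y \<in> e}"] by simp
    qed
    have "?P F' (insert y A) \<le> z ^ card (insert y A) * g ^ card (?T F' (insert y A)) / z ^ n"
      by (rule IH) (use finA in auto)
    \<comment> \<open>Only an inequality: \<open>y\<close> may already lie in \<open>A\<close>, or
      bring fewer edges. As \<open>z\<close> and \<open>g\<close> are at least 1, larger exponents
      are harmless.\<close>
    also have "\<dots> \<le> z ^ Suc (card A) * g ^ (b + (d - 1)) / z ^ n"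
    proof (intro divide_right_mono mult_mono power_increasing new_edges)
      show "card (insert y A) \<le> Suc (card A)"
        by (rule card_insert_le_m1) auto
    qed (use g z in auto)
    finally have opened: "?P F' (insert y A) \<le> z ^ Suc (card A) * g ^ (b + (d - 1)) / z ^ n" .
    \<comment> \<open>The weight left if the edge is closed; an open edge costs at most the further
      factor \<open>z * g ^ (d - 1)\<close>.\<close>
    define c where "c = z ^ card A * g ^ b / z ^ n"
    have "?P F A = p * ?P F' (insert y A) + (1 - p) * ?P F' A"
      using measure_bond_percolation_insert[OF F(3,2) p, of "\<lambda>G. enat n \<le> ecard (reach G A)"]
      unfolding F(1)[symmetric] reach_insert[OF xy(2)] .
    also have "\<dots> \<le> p * (c * (z * g ^ (d - 1))) + (1 - p) * c"
    proof (intro add_mono mult_left_mono)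
      show "?P F' (insert y A) \<le> c * (z * g ^ (d - 1))"
        using opened by (simp add: c_def power_add mult_ac)
    qed (use p closed in \<open>simp_all add: c_def\<close>)
    also have "\<dots> = c * (1 - p + p * z * g ^ (d - 1))"
      by (simp add: algebra_simps)
    \<comment> \<open>By \<open>gz\<close> the averaged factor is at most \<open>g\<close>, which is
      the share of the revealed edge in the weight before it was revealed.\<close>
    also have "\<dots> \<le> c * g"
      using gz z g by (intro mult_left_mono) (simp_all add: c_def)
    also have "\<dots> = z ^ card A * g ^ card (?T F A) / z ^ n"
      by (simp add: b c_def)
    finally show ?thesis .
  qed
qed

section \<open>Exhaustion of an infinite graph by finite edge sets\<close>

lemma countable_edges:
  assumes "simple_graph V E"
  shows "countable E"
proof (rule countable_subset)
  show "E \<subseteq> (\<lambda>(u, v). {u, v}) ` (V \<times> V)"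
  proof
    fix e assume "e \<in> E"
    with assms obtain u v where "u \<in> V" "v \<in> V" "e = {u, v}"
      unfolding simple_graph_def by blast
    then show "e \<in> (\<lambda>(u, v). {u, v}) ` (V \<times> V)"
      by auto
  qed
  show "countable ((\<lambda>(u, v). {u, v}) ` (V \<times> V))"
    using assms by (auto simp: simple_graph_def)
qed

lemma finite_subset_incseq_Union:
  assumes "incseq F" and "finite A" and "A \<subseteq> (\<Union>k. F k)"
  shows "\<exists>k. A \<subseteq> F k"
proof -
  have linear: "F i \<subseteq> F j \<or> F j \<subseteq> F i" for i j
    using linear[of i j] monoD[OF assms(1)] by blast
  have chain: "subset.chain UNIV (range F)"
    unfolding subset_chain_def using linear by auto
  obtain G where "G \<in> range F" "A \<subseteq> G"
    by (rule finite_subset_Union_chain[OF assms(2,3) _ chain]) auto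
  then show ?thesis
    by blast
qed

text \<open>The finite bound does not depend on the number of edges, so it survives the limit along
  an increasing exhaustion, by continuity of the measure from below.\<close>

lemma measure_cluster_ge_le:
  fixes g z p :: real and d n :: nat
  assumes p: "0 \<le> p" "p \<le> 1" and g: "1 \<le> g" and z: "1 \<le> z"
    and gz: "1 - p + p * z * g ^ (d - 1) \<le> g"
    and graph: "simple_graph V E" and deg: "max_degree V E \<le> enat d"
  shows "measure (bond_percolation E p)
      {\<omega> \<in> space (bond_percolation E p). ecard (cluster (open_edges E \<omega>) v) \<ge> enat n}
    \<le> z * g ^ d / z ^ n"
proof -
  interpret prob_space "bond_percolation E p"
    by (rule prob_space_bond_percolation)
  \<comment> \<open>Points outside \<open>V\<close> lie on no edge, so the degree bound holds at
    every point, as the finite bound demands.\<close>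
  have degE: "finite {e \<in> E. x \<in> e} \<and> card {e \<in> E. x \<in> e} \<le> d" for x
  proof (cases "x \<in> V")
    case True
    then have "degree E x \<le> enat d"
      using deg by (auto simp: max_degree_def SUP_le_iff)
    then show ?thesis
      by (auto simp: degree_def dest: finite_card_le_of_ecard_le)
  next
    case False
    then have empty: "{e \<in> E. x \<in> e} = {}"
      using graph by (auto simp: simple_graph_def)
    show ?thesis
      unfolding empty by simp
  qed
  obtain F where F: "\<And>k. finite (F k)" "incseq F" "(\<Union>k. F k) = E"
  proof (cases "E = {}")
    \<comment> \<open>Treated apart because \<open>from_nat_into\<close> enumerates only nonempty
      sets.\<close>
    case True
    then show ?thesis
      by (intro that[of "\<lambda>_. {}"]) (auto simp: incseq_def)
  next
    case False
    let ?f = "from_nat_into E"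
    show ?thesis
    proof (rule that[of "\<lambda>k. ?f ` {..k}"])
      show "(\<Union>k. ?f ` {..k}) = E"
        using range_from_nat_into[OF False countable_edges[OF graph]]
        by (simp add: image_UN[symmetric] UN_atMost_UNIV)
    qed (auto simp: incseq_def)
  qed
  define S where "S k = {\<omega> \<in> space (bond_percolation E p).
      ecard (reach (open_edges (F k) \<omega>) {v}) \<ge> enat n}" for k
  have S_sets: "S k \<in> events" for k
    unfolding S_def using F by (intro sets_bond_percolation_open_edges) auto
  have bound: "prob (S k) \<le> z * g ^ d / z ^ n" for k
  proof -
    have sub: "F k \<subseteq> E"
      using F by auto
    have card: "card {e \<in> F k. x \<in> e} \<le> d" for x
      using degE[of x] sub by (auto intro: order.trans[OF card_mono])
    have "prob (S k) \<le> z ^ card {v} * g ^ card {e \<in> F k. e \<inter> {v} \<noteq> {}} / z ^ n"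
      unfolding S_def
        measure_bond_percolation_restrict[OF F(1) sub, of p "\<lambda>G. ecard (reach G {v}) \<ge> enat n"]
    proof (rule measure_reach_ge_le[OF p g z gz F(1) _ _ card])
      show "\<exists>x y. e = {x, y}" if "e \<in> F k" for e
        using that sub graph unfolding simple_graph_def by blast
    qed simp
    \<comment> \<open>The exploration starts from one vertex with at most \<open>d\<close> touching
      edges.\<close>
    also have "\<dots> \<le> z * g ^ d / z ^ n"
      using card[of v] g z
      by (intro divide_right_mono mult_mono power_increasing) auto
    finally show ?thesis .
  qed
  have inc: "incseq S"
  proof (rule monoI)
    fix i j :: nat
    assume "i \<le> j"
    then have "open_edges (F i) \<omega> \<subseteq> open_edges (F j) \<omega>" for \<omega>
      using monoD[OF F(2)] unfolding open_edges_def by blast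
    then have "ecard (reach (open_edges (F i) \<omega>) {v}) \<le> ecard (reach (open_edges (F j) \<omega>) {v})" for \<omega>
      by (intro ecard_mono reach_mono order.refl)
    then show "S i \<subseteq> S j"
      unfolding S_def by (auto intro: order.trans)
  qed
  \<comment> \<open>Any \<open>n\<close> vertices of the cluster are joined to \<open>v\<close> by
    finitely many open edges, all of which belong to some \<open>F k\<close>.\<close>
  have Union: "{\<omega> \<in> space (bond_percolation E p). ecard (cluster (open_edges E \<omega>) v) \<ge> enat n}
      = (\<Union>k. S k)"
  proof (intro equalityI subsetI)
    fix \<omega>
    assume "\<omega> \<in> {\<omega> \<in> space (bond_percolation E p). ecard (cluster (open_edges E \<omega>) v) \<ge> enat n}"
    then have \<omega>: "\<omega> \<in> space (bond_percolation E p)"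
      and "enat n \<le> ecard (reach (open_edges E \<omega>) {v})"
      by (auto simp: cluster_eq_reach)
    then obtain B where B: "finite B" "card B = n" "B \<subseteq> reach (open_edges E \<omega>) {v}"
      unfolding enat_le_ecard_iff by blast
    then obtain F' where F': "F' \<subseteq> open_edges E \<omega>" "finite F'" "B \<subseteq> reach F' {v}"
      using reach_finite_subset[OF B(1,3)] by blast
    have "F' \<subseteq> \<Union> (range F)"
      using F'(1) F(3) by (auto simp: open_edges_def)
    then obtain k where "F' \<subseteq> F k"
      using finite_subset_incseq_Union[OF F(2) F'(2)] by blast
    then have "F' \<subseteq> open_edges (F k) \<omega>"
      using F'(1) by (auto simp: open_edges_def)
    then have "B \<subseteq> reach (open_edges (F k) \<omega>) {v}"
      by (intro order.trans[OF F'(3)] reach_mono order.refl)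
    then show "\<omega> \<in> (\<Union>k. S k)"
      using B(1,2) \<omega> unfolding S_def enat_le_ecard_iff by blast
  next
    fix \<omega>
    assume "\<omega> \<in> (\<Union>k. S k)"
    then obtain k where \<omega>: "\<omega> \<in> space (bond_percolation E p)"
      and k: "enat n \<le> ecard (reach (open_edges (F k) \<omega>) {v})"
      by (auto simp: S_def)
    have "open_edges (F k) \<omega> \<subseteq> open_edges E \<omega>"
      using F(3) by (auto simp: open_edges_def)
    then have "ecard (reach (open_edges (F k) \<omega>) {v}) \<le> ecard (reach (open_edges E \<omega>) {v})"
      by (intro ecard_mono reach_mono) auto
    with \<omega> k show "\<omega> \<in> {\<omega> \<in> space (bond_percolation E p). ecard (cluster (open_edges E \<omega>) v) \<ge> enat n}"
      by (auto simp: cluster_eq_reach)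
  qed
  have "(\<lambda>k. prob (S k)) \<longlonglongrightarrow> prob (\<Union>k. S k)"
    using S_sets inc by (intro finite_Lim_measure_incseq) auto
  then show ?thesis
    unfolding Union using bound by (intro LIMSEQ_le_const2) auto
qed

section \<open>Choice of the weights and of the decay rate\<close>

(* Subcriticality says that x - (1 - p + p x^m) has positive derivative at its zero x = 1. *)
lemma exists_supersolution:
  fixes p :: real and m :: nat
  assumes "0 \<le> p" "p \<le> 1" and "p * real m < 1"
  shows "\<exists>g>1. \<exists>z>1. 1 - p + p * z * g ^ m \<le> g"
proof -
  define f where "f = (\<lambda>x. x - (1 - p + p * x ^ m))"
  have "(f has_real_derivative (1 - p * real m)) (at 1)"
    unfolding f_def by (auto intro!: derivative_eq_intros)
  from DERIV_pos_inc_right[OF this] assms(3)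
  obtain \<delta> where "\<delta> > 0" and \<delta>: "\<And>h. 0 < h \<Longrightarrow> h < \<delta> \<Longrightarrow> f 1 < f (1 + h)"
    by auto
  define g where "g = 1 + \<delta> / 2"
  have g: "g > 1"
    using \<open>\<delta> > 0\<close> by (simp add: g_def)
  have f: "f g > 0"
    using \<delta>[of "\<delta> / 2"] \<open>\<delta> > 0\<close> by (simp add: g_def f_def)
  \<comment> \<open>Spends the slack \<open>f g\<close>: raising \<open>z\<close> from 1 to this
    value adds \<open>p * f g\<close> to the left side, at most \<open>f g\<close> since
    \<open>p \<le> 1\<close>.\<close>
  define z where "z = 1 + f g / g ^ m"
  have "p * z * g ^ m = p * g ^ m + p * f g"
    using g by (simp add: z_def field_simps)
  also have "\<dots> \<le> p * g ^ m + f g"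
    using assms f by (simp add: mult_left_le_one_le)
  finally have "1 - p + p * z * g ^ m \<le> g"
    by (simp add: f_def)
  moreover have "z > 1"
    using f g by (simp add: z_def)
  ultimately show ?thesis
    using g by blast
qed

text \<open>Interpolation with the trivial bound 1: for \<open>s\<close> in [0, 1], \<open>q\<close>
  is at most the \<open>s\<close>-th power of \<open>K / z ^ n\<close>. This turns the prefactor
  into \<open>K\<close> to the power \<open>s\<close> and the rate into
  \<open>s * ln z\<close>.\<close>

lemma exp_decay_normalize_constant:
  fixes K z :: real
  assumes "1 < K" and "1 < z"
  shows "\<exists>lam>0. \<forall>q (n::nat). q \<le> 1 \<longrightarrow> q \<le> K / z ^ n \<longrightarrow> q \<le> 2 * exp (- (real n * lam))"
proof -
  \<comment> \<open>The largest exponent up to 1 for which the \<open>s\<close>-th power of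
    \<open>K\<close> is at most 2.\<close>
  define s where "s = min 1 (ln 2 / ln K)"
  have lnK: "0 < ln K" and lnz: "0 < ln z"
    using assms by auto
  have s: "0 < s" "s \<le> 1"
    using lnK by (auto simp: s_def)
  have "s * ln K \<le> ln 2 / ln K * ln K"
    unfolding s_def using lnK by (intro mult_right_mono) auto
  then have sK: "s * ln K \<le> ln 2"
    using lnK by simp
  have "q \<le> 2 * exp (- (real n * (s * ln z)))" if q: "q \<le> 1" "q \<le> K / z ^ n" for q n
  proof -
    define x where "x = ln K - real n * ln z"
    have "K / z ^ n = exp x"
      using assms by (simp add: x_def exp_diff exp_of_nat_mult)
    with q have "q \<le> exp (min 0 x)"
      by (auto simp: min_def)
    \<comment> \<open>For \<open>x \<ge> 0\<close> the left side is 0; for negative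
      \<open>x\<close>, scaling by \<open>s \<le> 1\<close> moves it towards 0.\<close>
    also have "min 0 x \<le> s * x"
      using s by (cases "x \<ge> 0") (auto simp: mult_le_cancel_right1)
    also have "s * x \<le> ln 2 - real n * (s * ln z)"
      using sK by (simp add: x_def algebra_simps)
    also have "exp (ln 2 - real n * (s * ln z)) = 2 * exp (- (real n * (s * ln z)))"
      by (simp add: exp_diff exp_minus field_simps)
    finally show ?thesis
      by simp
  qed
  then show ?thesis
    using s lnz by (intro exI[of _ "s * ln z"]) auto
qed

section \<open>A rate common to all graphs and vertices\<close>

theorem theorem7p4:
  fixes r p :: real and d_max :: nat and l_max :: ennreal
  assumes "r > 0"
    and "d_max \<noteq> 1"
    and "l_max < \<infinity>"
    and "0 \<le> p" and "p < 1 / (real d_max - 1)"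
  shows "\<exists>lam::real. lam > 0 \<and>
    (\<forall>(V :: (real ^ 'n) set) E.
       simple_graph V E \<longrightarrow> uniformly_discrete_of_radius r V \<longrightarrow>
       max_degree V E = enat d_max \<longrightarrow> max_edge_length E = l_max \<longrightarrow>
       (\<forall>v\<in>V. \<forall>n::nat.
          measure (bond_percolation E p)
            {\<omega> \<in> space (bond_percolation E p).
               ecard (cluster (open_edges E \<omega>) v) \<ge> enat n}
          \<le> 2 * exp (- (real n * lam))))"
proof -
  \<comment> \<open>For \<open>d_max = 0\<close> the upper bound on \<open>p\<close> would be -1,
    against \<open>0 \<le> p\<close>.\<close>
  have "d_max \<noteq> 0"
  proof
    assume "d_max = 0"
    with assms(4,5) show False
      by simp
  qed
  with assms(2) have d: "d_max \<ge> 2"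
    by simp
  then have pd: "p * real (d_max - 1) < 1"
    using assms(5) by (simp add: field_simps)
  have "1 / (real d_max - 1) \<le> 1"
    using d by simp
  with assms(5) have "p \<le> 1"
    by simp
  \<comment> \<open>The weights, and below the rate \<open>lam\<close>, are fixed before any graph
    or vertex is introduced; this gives the uniformity.\<close>
  from exists_supersolution[OF assms(4) this pd]
  obtain g z where gz: "g > 1" "z > 1" "1 - p + p * z * g ^ (d_max - 1) \<le> g"
    by blast
  have "1 * 1 < z * g ^ d_max"
    using gz d by (intro mult_strict_mono) auto
  with exp_decay_normalize_constant[of "z * g ^ d_max" z] gz(2)
  obtain lam where "lam > 0" and lam: "\<And>q n. q \<le> 1 \<Longrightarrow> q \<le> z * g ^ d_max / z ^ n \<Longrightarrow>
      q \<le> 2 * exp (- (real n * lam))"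
    by auto
  show ?thesis
  \<comment> \<open>Applying \<open>lam\<close> leaves two bounds on the probability: the geometric
    one, and the trivial bound 1, which the closing \<open>qed\<close> supplies.\<close>
  proof (intro exI[of _ lam] conjI allI impI ballI lam)
    show "lam > 0"
      by fact
  next
    fix V :: "(real ^ 'n) set" and E v and n :: nat
    assume "simple_graph V E" and "max_degree V E = enat d_max"
    then show "measure (bond_percolation E p)
        {\<omega> \<in> space (bond_percolation E p). ecard (cluster (open_edges E \<omega>) v) \<ge> enat n}
      \<le> z * g ^ d_max / z ^ n"
      using assms(4) \<open>p \<le> 1\<close> gz by (intro measure_cluster_ge_le[where V = V]) auto
  qed (rule prob_space.prob_le_1[OF prob_space_bond_percolation])
qed

end
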